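(* Let $n\ge 0$ and let $a_0,\ldots,a_{2n+1},b$ be nonnegative integers, and set $S=\sum_{0\le i\le 2n+1,\ i \text{ even}} a_i$. Then $$o^-\Big(\sum_{i=0}^{2n+1}a_i\tau^i+b\,\mathsf{L}(\tau^{2n+1})\Big)=\begin{cases}\mathcal{R} & \text{if } a_i=0 \text{ for all } i \text{ and } b\equiv 1 \pmod 2,\\ \mathcal{N} & \text{if } S+b\equiv 0\pmod 2,\\ \mathcal{P} & \text{if } S+b\equiv 1\pmod 2 \text{ and } a_i\neq 0 \text{ for some } i.\end{cases}$$
   Context: A position $\xi=\{\xi^L \mid \xi^R\}$ is given recursively by finite sets of Left and Right options; $\cdot$ denotes an empty set. $*=\{0\mid0\}$, $\tau^0=*$, $\tau^k=\{\tau^{k-1}\mid\tau^{k-1}\}$ for $k\ge1$, and $\mathsf{L}(\xi)=\{\xi\mid\cdot\}$. $k\xi$ denotes the disjunctive sum of $k$ copies of $\xi$; disjunctive sum: $\alpha+\beta=\{\alpha^L+\beta,\alpha+\beta^L \mid \alpha^R+\beta,\alpha+\beta^R\}$. Under misère play a player unable to move on their turn wins; the misère outcome $o^-$ is $\mathcal{L}$ (Left wins moving first or second), $\mathcal{R}$ (Right wins moving first or second), $\mathcal{N}$ (next player wins) or $\mathcal{P}$ (next player loses). *)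

theory Defs
  imports Main "HOL-Library.FSet"
begin

datatype position = Position (left_opts: "position fset") (right_opts: "position fset")

lemma size_left_option: "\<xi>' |\<in>| left_opts \<xi> \<Longrightarrow> size \<xi>' < size \<xi>"
  by (cases \<xi>) (auto simp: less_Suc_eq_le intro!: trans_le_add1 
      order_trans[OF _ member_le_sum[of \<xi>' _ "\<lambda>x. Suc (size x)"]])

lemma size_right_option: "\<xi>' |\<in>| right_opts \<xi> \<Longrightarrow> size \<xi>' < size \<xi>"
  by (cases \<xi>) (auto simp: less_Suc_eq_le intro!: trans_le_add2
      order_trans[OF _ member_le_sum[of \<xi>' _ "\<lambda>x. Suc (size x)"]])

instantiation position :: "{zero, plus}"
begin

definition zero_position :: position where
  "0 = Position {||} {||}"

function plus_position :: "position \<Rightarrow> position \<Rightarrow> position" where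
  "\<alpha> + \<beta> = Position
     ((\<lambda>\<alpha>'. \<alpha>' + \<beta>) |`| left_opts \<alpha> |\<union>| (\<lambda>\<beta>'. \<alpha> + \<beta>') |`| left_opts \<beta>)
     ((\<lambda>\<alpha>'. \<alpha>' + \<beta>) |`| right_opts \<alpha> |\<union>| (\<lambda>\<beta>'. \<alpha> + \<beta>') |`| right_opts \<beta>)"
  by pat_completeness auto
termination
  by (relation "measure (\<lambda>(\<alpha>, \<beta>). size \<alpha> + size \<beta>)")
    (auto dest: size_left_option size_right_option)

instance ..

end

declare plus_position.simps [simp del]

lemma left_opts_plus:
  "left_opts (\<alpha> + \<beta>) =
     (\<lambda>\<alpha>'. \<alpha>' + \<beta>) |`| left_opts \<alpha> |\<union>| (\<lambda>\<beta>'. \<alpha> + \<beta>') |`| left_opts \<beta>"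
  by (subst plus_position.simps) simp

lemma right_opts_plus:
  "right_opts (\<alpha> + \<beta>) =
     (\<lambda>\<alpha>'. \<alpha>' + \<beta>) |`| right_opts \<alpha> |\<union>| (\<lambda>\<beta>'. \<alpha> + \<beta>') |`| right_opts \<beta>"
  by (subst plus_position.simps) simp

instance position :: comm_monoid_add
proof
  fix \<alpha> \<beta> \<gamma> :: position
  show "\<alpha> + \<beta> + \<gamma> = \<alpha> + (\<beta> + \<gamma>)"
  proof (induction "size \<alpha> + size \<beta> + size \<gamma>" arbitrary: \<alpha> \<beta> \<gamma> rule: less_induct)
    case less
    have
      "\<alpha>' |\<in>| left_opts \<alpha> |\<union>| right_opts \<alpha> \<Longrightarrow> \<alpha>' + \<beta> + \<gamma> = \<alpha>' + (\<beta> + \<gamma>)"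
      "\<beta>' |\<in>| left_opts \<beta> |\<union>| right_opts \<beta> \<Longrightarrow> \<alpha> + \<beta>' + \<gamma> = \<alpha> + (\<beta>' + \<gamma>)"
      "\<gamma>' |\<in>| left_opts \<gamma> |\<union>| right_opts \<gamma> \<Longrightarrow> \<alpha> + \<beta> + \<gamma>' = \<alpha> + (\<beta> + \<gamma>')"
      for \<alpha>' \<beta>' \<gamma>'
      by (rule less; auto dest: size_left_option size_right_option)+
    then show ?case
      by (intro position.expand conjI)
        (simp_all add: left_opts_plus right_opts_plus fimage_funion fset.map_comp
          comp_def funion_assoc cong: fset.map_cong)
  qed
  show "\<alpha> + \<beta> = \<beta> + \<alpha>"
  proof (induction "size \<alpha> + size \<beta>" arbitrary: \<alpha> \<beta> rule: less_induct)
    case less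
    have
      "\<alpha>' |\<in>| left_opts \<alpha> |\<union>| right_opts \<alpha> \<Longrightarrow> \<alpha>' + \<beta> = \<beta> + \<alpha>'"
      "\<beta>' |\<in>| left_opts \<beta> |\<union>| right_opts \<beta> \<Longrightarrow> \<alpha> + \<beta>' = \<beta>' + \<alpha>"
      for \<alpha>' \<beta>'
      by (rule less; auto dest: size_left_option size_right_option)+
    then show ?case
      by (intro position.expand conjI)
        (simp_all add: left_opts_plus right_opts_plus funion_commute cong: fset.map_cong)
  qed
  show "0 + \<alpha> = \<alpha>"
  proof (induction "size \<alpha>" arbitrary: \<alpha> rule: less_induct)
    case less
    have "\<alpha>' |\<in>| left_opts \<alpha> |\<union>| right_opts \<alpha> \<Longrightarrow> 0 + \<alpha>' = \<alpha>'" for \<alpha>'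
      by (rule less; auto dest: size_left_option size_right_option)
    then show ?case
      by (intro position.expand conjI)
        (simp_all add: left_opts_plus right_opts_plus zero_position_def cong: fset.map_cong)
  qed
qed

primrec copies :: "nat \<Rightarrow> position \<Rightarrow> position" where
  "copies 0 \<xi> = 0"
| "copies (Suc k) \<xi> = \<xi> + copies k \<xi>"

definition star :: position where
  "star = Position {|0|} {|0|}"

primrec tau :: "nat \<Rightarrow> position" where
  "tau 0 = star"
| "tau (Suc k) = Position {|tau k|} {|tau k|}"

definition left_to :: "position \<Rightarrow> position" where
  "left_to \<xi> = Position {|\<xi>|} {||}"

datatype player = Left | Right

primrec opponent :: "player \<Rightarrow> player" where
  "opponent Left = Right"
| "opponent Right = Left"

primrec options :: "player \<Rightarrow> position \<Rightarrow> position fset" where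
  "options Left = left_opts"
| "options Right = right_opts"

lemma size_option: "\<xi>' |\<in>| options p \<xi> \<Longrightarrow> size \<xi>' < size \<xi>"
  by (cases p) (auto dest: size_left_option size_right_option)

function misere_wins_first :: "player \<Rightarrow> position \<Rightarrow> bool"
  and misere_wins_second :: "player \<Rightarrow> position \<Rightarrow> bool" where
  "misere_wins_first p \<xi> \<longleftrightarrow>
     options p \<xi> = {||} \<or> (\<exists>\<xi>' |\<in>| options p \<xi>. misere_wins_second p \<xi>')"
| "misere_wins_second p \<xi> \<longleftrightarrow>
     options (opponent p) \<xi> \<noteq> {||} \<and>
     (\<forall>\<xi>' |\<in>| options (opponent p) \<xi>. misere_wins_first p \<xi>')"
  by pat_completeness auto
termination
  by (relation "measure (case_sum (size \<circ> snd) (size \<circ> snd))") (auto dest: size_option)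

declare misere_wins_first.simps [simp del] misere_wins_second.simps [simp del]

lemma misere_wins_second_iff: "misere_wins_second p \<xi> \<longleftrightarrow> \<not> misere_wins_first (opponent p) \<xi>"
proof (induction "size \<xi>" arbitrary: p \<xi> rule: less_induct)
  case less
  have "opponent (opponent p) = p"
    by (cases p) auto
  then have "misere_wins_second (opponent p) \<xi>' \<longleftrightarrow> \<not> misere_wins_first p \<xi>'"
    if "\<xi>' |\<in>| options (opponent p) \<xi>" for \<xi>'
    using less[of \<xi>' "opponent p"] size_option[OF that] by simp
  then show ?case
    by (auto simp: misere_wins_first.simps[of "opponent p" \<xi>] misere_wins_second.simps[of p \<xi>])
qed

datatype outcome = Outcome_L | Outcome_R | Outcome_N | Outcome_P

text \<open>
  By \<open>misere_wins_second_iff\<close> the final branch is exactly the case in which neither player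
  wins moving first, i.e. the next player loses.
\<close>

definition misere_outcome :: "position \<Rightarrow> outcome" where
  "misere_outcome \<xi> =
     (if misere_wins_first Left \<xi> \<and> misere_wins_second Left \<xi> then Outcome_L
      else if misere_wins_first Right \<xi> \<and> misere_wins_second Right \<xi> then Outcome_R
      else if misere_wins_first Left \<xi> \<and> misere_wins_first Right \<xi> then Outcome_N
      else Outcome_P)"

end

theory Submission
  imports Defs "HOL-Library.Multiset"
begin

text \<open>
  Every move flips the parity of \<open>S + b\<close>: a move in \<open>\<tau>\<^sup>i\<close> changes \<open>S\<close> by one, and Left's move from
  \<open>L(\<tau>\<^sup>m)\<close> to \<open>\<tau>\<^sup>m\<close> lowers \<open>b\<close> while \<open>S\<close> is unchanged since \<open>m\<close> is odd. The zero position has even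
  parity and is a win for the next player, so play is decided by parity alone, except that Right,
  having no move in \<open>L(\<tau>\<^sup>m)\<close>, also wins moving first once no \<open>\<tau>\<^sup>i\<close> is left. With even parity Left
  can always avoid creating such a position.
\<close>

text \<open>A multiset rather than an index, because the only option of \<open>tau 0\<close> is
  \<open>0\<close>, the empty sum of \<open>tau\<close>s.\<close>

definition tau_followers :: "nat \<Rightarrow> nat multiset" where
  "tau_followers i = (if i = 0 then {#} else {#i - 1#})"

definition tau_sum :: "nat multiset \<Rightarrow> position" where
  "tau_sum M = (\<Sum>i\<in>#M. tau i)"

text \<open>This is the S of the theorem when \<open>M\<close> contains each \<open>i\<close>
  exactly \<open>a i\<close> times.\<close>

definition even_count :: "nat multiset \<Rightarrow> nat" where
  "even_count M = size (filter_mset even M)"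

lemma tau_sum_simps [simp]:
  "tau_sum {#} = 0"
  "tau_sum (add_mset i M) = tau i + tau_sum M"
  "tau_sum (M + N) = tau_sum M + tau_sum N"
  by (simp_all add: tau_sum_def)

lemma even_count_simps [simp]:
  "even_count {#} = 0"
  "even_count (add_mset i M) = (if even i then Suc (even_count M) else even_count M)"
  "even_count (M + N) = even_count M + even_count N"
  by (simp_all add: even_count_def)

lemma option_plus_iff:
  "\<xi> |\<in>| options p (\<alpha> + \<beta>) \<longleftrightarrow>
     (\<exists>\<alpha>'. \<alpha>' |\<in>| options p \<alpha> \<and> \<xi> = \<alpha>' + \<beta>) \<or>
     (\<exists>\<beta>'. \<beta>' |\<in>| options p \<beta> \<and> \<xi> = \<alpha> + \<beta>')"
  by (cases p) (auto simp: left_opts_plus right_opts_plus)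

lemma options_zero [simp]: "options p 0 = {||}"
  by (cases p) (simp_all add: zero_position_def)

lemma options_tau: "options p (tau i) = {|tau_sum (tau_followers i)|}"
  by (cases p; cases i) (simp_all add: star_def tau_followers_def)

lemma options_left_to:
  "options p (left_to \<xi>) = (if p = Left then {|\<xi>|} else {||})"
  by (cases p) (simp_all add: left_to_def)

text \<open>Each \<open>tau i\<close> has the same single option for both players, so a move only
  amounts to choosing an index in \<open>M\<close>, and \<open>p\<close> is absent from the
  right-hand side.\<close>

lemma option_tau_sum_iff:
  "\<xi> |\<in>| options p (tau_sum M) \<longleftrightarrow>
     (\<exists>i N. M = add_mset i N \<and> \<xi> = tau_sum (tau_followers i + N))"
proof (induction M arbitrary: \<xi>)
  case empty
  then show ?case by simp
next
  case (add j M)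
  show ?case (is "?lhs \<longleftrightarrow> ?rhs")
  proof
    assume ?lhs
    then consider "\<xi> = tau_sum (tau_followers j) + tau_sum M"
      | \<xi>' where "\<xi>' |\<in>| options p (tau_sum M)" "\<xi> = tau j + \<xi>'"
      by (auto simp: option_plus_iff options_tau)
    then show ?rhs
    proof cases
      case 1
      then show ?thesis by auto
    next
      case 2
      then obtain i N where "M = add_mset i N" "\<xi>' = tau_sum (tau_followers i + N)"
        using add.IH by blast
      then have "add_mset j M = add_mset i (add_mset j N)"
        "\<xi> = tau_sum (tau_followers i + add_mset j N)"
        using 2 by (simp_all add: ac_simps)
      then show ?thesis by blast
    qed
  next
    assume ?rhs
    then obtain i N where iN: "add_mset j M = add_mset i N"
      "\<xi> = tau_sum (tau_followers i + N)" by blast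
    show ?lhs
    \<comment> \<open>Equal indices are interchangeable, so for i = j the moved summand can be taken
      to be the head \<open>tau j\<close>; otherwise the move happens inside
      \<open>M\<close>.\<close>
    proof (cases "i = j")
      case True
      then show ?thesis using iN by (simp add: option_plus_iff options_tau)
    next
      case False
      then obtain K where K: "M = add_mset i K" "N = add_mset j K"
        using iN by (auto simp: add_eq_conv_ex)
      then have "tau_sum (tau_followers i + K) |\<in>| options p (tau_sum M)"
        using add.IH by blast
      moreover have "\<xi> = tau j + tau_sum (tau_followers i + K)"
        using iN K by (simp add: ac_simps)
      ultimately show ?thesis by (auto simp: option_plus_iff)
    qed
  qed
qed

text \<open>Sums commute, so moving in any of the equal copies leads to the same position.\<close>

lemma option_copies_left_to_iff:
  "\<xi> |\<in>| options p (copies b (left_to \<eta>)) \<longleftrightarrow>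
     p = Left \<and> (\<exists>c. b = Suc c \<and> \<xi> = \<eta> + copies c (left_to \<eta>))"
proof (induction b arbitrary: \<xi>)
  case 0
  then show ?case by simp
next
  case (Suc b)
  have "\<xi> |\<in>| options p (copies (Suc b) (left_to \<eta>)) \<longleftrightarrow> p = Left \<and>
      (\<xi> = \<eta> + copies b (left_to \<eta>) \<or>
       (\<exists>c. b = Suc c \<and> \<xi> = left_to \<eta> + (\<eta> + copies c (left_to \<eta>))))"
    unfolding copies.simps option_plus_iff Suc.IH options_left_to by auto
  then show ?case by (auto simp: add.left_commute)
qed

text \<open>The family of positions is closed under moves: the \<open>tau m\<close> released by Left
  joins the multiset.\<close>

lemma option_tau_sum_plus_copies_iff:
  "\<xi> |\<in>| options p (tau_sum M + copies b (left_to (tau m))) \<longleftrightarrow>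
     (\<exists>i N. M = add_mset i N \<and>
        \<xi> = tau_sum (tau_followers i + N) + copies b (left_to (tau m))) \<or>
     p = Left \<and> (\<exists>c. b = Suc c \<and> \<xi> = tau_sum (add_mset m M) + copies c (left_to (tau m)))"
proof -
  have "tau_sum (add_mset m M) + \<gamma> = tau_sum M + (tau m + \<gamma>)" for \<gamma>
    by (simp add: ac_simps)
  then show ?thesis
    unfolding option_plus_iff option_tau_sum_iff option_copies_left_to_iff by metis
qed

lemma misere_wins_first_iff:
  "misere_wins_first p \<xi> \<longleftrightarrow>
     options p \<xi> = {||} \<or> (\<exists>\<xi>'. \<xi>' |\<in>| options p \<xi> \<and> \<not> misere_wins_first (opponent p) \<xi>')"
  by (auto simp: misere_wins_first.simps[of p \<xi>] misere_wins_second_iff)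

text \<open>For i > 0 the index passes to i - 1 of opposite parity; for i = 0 an even index
  disappears.\<close>

lemma even_even_count_tau_followers:
  "even (even_count (tau_followers i + N)) \<longleftrightarrow> odd (even_count (add_mset i N))"
  by (auto simp: tau_followers_def)

text \<open>The induction is on the size of the position, not on \<open>M\<close>, because Left's
  move in \<open>left_to (tau m)\<close> enlarges \<open>M\<close>; \<open>p\<close> varies because
  each move hands over the turn.\<close>

lemma misere_wins_first_tau_sum_iff:
  assumes "odd m"
  shows "misere_wins_first p (tau_sum M + copies b (left_to (tau m))) \<longleftrightarrow>
    even (even_count M + b) \<or> p = Right \<and> M = {#}"
proof (induction "size (tau_sum M + copies b (left_to (tau m)))" arbitrary: p M b rule: less_induct)
  case less
  let ?G = "\<lambda>M b. tau_sum M + copies b (left_to (tau m))"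
  note opt = option_tau_sum_plus_copies_iff
  have tau_move: "misere_wins_first q (?G (tau_followers i + N) b) \<longleftrightarrow>
      odd (even_count M + b) \<or> q = Right \<and> tau_followers i + N = {#}"
    if "M = add_mset i N" for q i N
  proof -
    have "?G (tau_followers i + N) b |\<in>| options p (?G M b)"
      using that opt by blast
    from less[OF size_option[OF this], of q] show ?thesis
      using even_even_count_tau_followers[of i N] that by auto
  qed
  \<comment> \<open>The new multiset contains \<open>m\<close>, so the exception for Right cannot
    arise; as \<open>m\<close> is odd, only \<open>b\<close> changes the parity.\<close>
  have left_move: "misere_wins_first q (?G (add_mset m M) c) \<longleftrightarrow> odd (even_count M + b)"
    if "b = Suc c" for q c
  proof -
    have "?G (add_mset m M) c |\<in>| options Left (?G M b)"
      using that opt by blast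
    from less[OF size_option[OF this], of q] show ?thesis
      using assms that by auto
  qed
  have no_move: "options p (?G M b) = {||} \<longleftrightarrow> M = {#} \<and> (p = Right \<or> b = 0)"
  proof -
    have "options p (?G M b) = {||} \<longleftrightarrow> (\<forall>\<xi>. \<not> \<xi> |\<in>| options p (?G M b))"
      by auto
    also have "\<dots> \<longleftrightarrow> M = {#} \<and> (p = Right \<or> b = 0)"
      unfolding opt by (cases p; cases b; cases M) auto
    finally show ?thesis .
  qed
  have "misere_wins_first p (?G M b) \<longleftrightarrow> M = {#} \<and> (p = Right \<or> b = 0) \<or>
    (\<exists>i N. M = add_mset i N \<and>
       \<not> misere_wins_first (opponent p) (?G (tau_followers i + N) b)) \<or>
    p = Left \<and> (\<exists>c. b = Suc c \<and> \<not> misere_wins_first (opponent p) (?G (add_mset m M) c))"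
    unfolding misere_wins_first_iff[of p] no_move opt by blast
  \<comment> \<open>Moving from even parity leaves the opponent losing, except when the opponent is
    Right and no \<open>tau\<close> remains. Only Left's \<open>tau\<close> moves run this
    risk.\<close>
  also have "\<dots> \<longleftrightarrow> M = {#} \<and> (p = Right \<or> b = 0) \<or>
    even (even_count M + b) \<and>
      ((\<exists>i N. M = add_mset i N \<and> (p = Right \<or> tau_followers i + N \<noteq> {#})) \<or>
       p = Left \<and> b \<noteq> 0)"
    proof (cases p)
    case Left
    then show ?thesis using tau_move[of _ _ Right] left_move[of _ Right] by (cases b) auto
  next
    case Right
    then show ?thesis using tau_move[of _ _ Left] by auto
  qed
  also have "\<dots> \<longleftrightarrow> even (even_count M + b) \<or> p = Right \<and> M = {#}"
  proof (cases "M = {#}")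
    \<comment> \<open>Here Right is stuck and wins at once. Left wins exactly for even
      \<open>b\<close>: stuck if b = 0, otherwise by a move in
      \<open>left_to (tau m)\<close>.\<close>
    case True
    then show ?thesis by (cases p) auto
  next
    case False
    then obtain i N where M: "M = add_mset i N"
      by (meson multiset_cases)
    \<comment> \<open>A \<open>tau\<close> move empties the multiset only from \<open>{#0#}\<close>,
      whose \<open>even_count\<close> is 1.\<close>
    have "tau_followers i + N \<noteq> {#}" if "even (even_count M)"
      using that M by (auto simp: tau_followers_def split: if_splits)
    \<comment> \<open>Left with b > 0 is left out, having the safe move in
      \<open>left_to (tau m)\<close>; for b = 0 the parity condition is that of
      \<open>even_count M\<close> alone.\<close>
    then have "\<exists>i N. M = add_mset i N \<and> (p = Right \<or> tau_followers i + N \<noteq> {#})"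
      if "even (even_count M + b)" "p = Right \<or> b = 0"
      using M that by auto
    then show ?thesis
      using False by (cases p) auto
  qed
  finally show ?case .
qed

lemma tau_sum_replicate_mset: "tau_sum (replicate_mset k i) = copies k (tau i)"
  by (induction k) simp_all

lemma sum_multiset_eq_empty_iff:
  fixes f :: "'a \<Rightarrow> 'b multiset"
  assumes "finite A"
  shows "(\<Sum>i\<in>A. f i) = {#} \<longleftrightarrow> (\<forall>i\<in>A. f i = {#})"
  using assms by (induction A) simp_all

lemma tau_sum_sum: "tau_sum (\<Sum>i\<in>A. f i) = (\<Sum>i\<in>A. tau_sum (f i))"
  by (induction A rule: infinite_finite_induct) simp_all

lemma even_count_sum: "even_count (\<Sum>i\<in>A. f i) = (\<Sum>i\<in>A. even_count (f i))"
  by (induction A rule: infinite_finite_induct) simp_all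

lemma even_count_replicate_mset: "even_count (replicate_mset k i) = (if even i then k else 0)"
  by (induction k) simp_all

theorem theorem3p4p4:
  fixes n b :: nat and a :: "nat \<Rightarrow> nat"
  defines "S \<equiv> \<Sum>i | i \<le> 2 * n + 1 \<and> even i. a i"
    and "G \<equiv> (\<Sum>i = 0..2 * n + 1. copies (a i) (tau i)) + copies b (left_to (tau (2 * n + 1)))"
  shows "((\<forall>i \<le> 2 * n + 1. a i = 0) \<and> odd b \<longrightarrow> misere_outcome G = Outcome_R) \<and>
    (even (S + b) \<longrightarrow> misere_outcome G = Outcome_N) \<and>
    (odd (S + b) \<and> (\<exists>i \<le> 2 * n + 1. a i \<noteq> 0) \<longrightarrow> misere_outcome G = Outcome_P)"
proof -
  define M where "M = (\<Sum>i = 0..2 * n + 1. replicate_mset (a i) i)"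
  have G: "G = tau_sum M + copies b (left_to (tau (2 * n + 1)))"
    by (simp only: G_def M_def tau_sum_sum tau_sum_replicate_mset)
  have "even_count M = (\<Sum>i = 0..2 * n + 1. if even i then a i else 0)"
    by (simp only: M_def even_count_sum even_count_replicate_mset)
  also have "\<dots> = (\<Sum>i \<in> {0..2 * n + 1} \<inter> {i. even i}. a i)"
    by (simp only: sum.inter_restrict finite_atLeastAtMost mem_Collect_eq)
  also have "{0..2 * n + 1} \<inter> {i. even i} = {i. i \<le> 2 * n + 1 \<and> even i}"
    by auto
  finally have S: "even_count M = S"
    by (simp only: S_def)
  have M_empty: "M = {#} \<longleftrightarrow> (\<forall>i \<le> 2 * n + 1. a i = 0)"
    unfolding M_def by (subst sum_multiset_eq_empty_iff) auto
  have first: "misere_wins_first p G \<longleftrightarrow>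
      even (S + b) \<or> p = Right \<and> (\<forall>i \<le> 2 * n + 1. a i = 0)" for p
    using misere_wins_first_tau_sum_iff[of "2 * n + 1" p M b] by (simp only: G S M_empty) simp
  \<comment> \<open>With no \<open>tau\<close> present the parity is that of \<open>b\<close>, so an
    odd \<open>b\<close> makes Right the only player who wins moving first.\<close>
  have "S = 0" if "\<forall>i \<le> 2 * n + 1. a i = 0"
    using that by (simp add: S_def)
  then show ?thesis
    unfolding misere_outcome_def misere_wins_second_iff first by auto
qed

end
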